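(* For all $d,r,g\in\mathbb{N}$, there exists a $(d,r,g)$-graph.
   Context: Graphs are finite and simple; $\mathbb{N}$ is the set of positive integers. The girth of a graph is the length of a shortest cycle. A complete $d$-ary tree of height $m$ is a rooted tree in which every internal (non-leaf) vertex has exactly $d$ children and every leaf is at distance $m$ from the root. An $r$-augmented tree is a graph consisting of a rooted tree (the underlying tree) plus, for each leaf of it, $r$ additional edges (augmenting edges) joining that leaf to $r$ distinct ancestors; since the graph is simple, these ancestors are not the parent of the leaf. A $(d,r,g)$-graph is a bipartite $r$-augmented complete $d$-ary tree (that is, the underlying tree is a complete $d$-ary tree of some height and the whole graph is bipartite) having girth at least $g$. *)

theory Defs
  imports "Graph_Theory.Graph_Theory" "HOL-Library.Extended_Nat"
begin

text \<open>
  A finite simple graph is a \<^locale>\<open>pair_graph\<close>: a finite loop-free digraph with symmetric arc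
  relation, an undirected edge being a pair of opposite arcs. Since every edge is therefore a
  directed cycle of length two in the sense of \<^const>\<open>pre_digraph.cycle\<close>, cycles of the
  undirected graph are required to have length at least three. For the same reason
  \<^const>\<open>tree\<close> cannot be used for undirected trees.
\<close>

definition graph_cycle :: "'a pair_pre_digraph \<Rightarrow> ('a \<times> 'a) awalk \<Rightarrow> bool" where
  "graph_cycle G p \<longleftrightarrow> pre_digraph.cycle (with_proj G) p \<and> 3 \<le> length p"

text \<open>The girth of an acyclic graph is infinite.\<close>

definition girth :: "'a pair_pre_digraph \<Rightarrow> enat" where
  "girth G = (INF p \<in> {p. graph_cycle G p}. enat (length p))"

definition bipartite :: "'a pair_pre_digraph \<Rightarrow> bool" where
  "bipartite G \<longleftrightarrow> (\<exists>X Y. pverts G = X \<union> Y \<and> X \<inter> Y = {} \<and>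
     parcs G \<subseteq> X \<times> Y \<union> Y \<times> X)"

definition rooted_tree :: "'a pair_pre_digraph \<Rightarrow> 'a \<Rightarrow> bool" where
  "rooted_tree T rt \<longleftrightarrow> pair_graph T \<and> connected (with_proj T) \<and>
     (\<nexists>p. graph_cycle T p) \<and> rt \<in> pverts T"

text \<open>Ancestors are proper: a vertex is not its own ancestor.\<close>

definition ancestor :: "'a pair_pre_digraph \<Rightarrow> 'a \<Rightarrow> 'a \<Rightarrow> 'a \<Rightarrow> bool" where
  "ancestor T rt u v \<longleftrightarrow> u \<noteq> v \<and>
     (\<exists>p. pre_digraph.apath (with_proj T) rt p v \<and> u \<in> set (pawalk_verts rt p))"

definition parent :: "'a pair_pre_digraph \<Rightarrow> 'a \<Rightarrow> 'a \<Rightarrow> 'a \<Rightarrow> bool" where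
  "parent T rt u v \<longleftrightarrow> (u, v) \<in> parcs T \<and> ancestor T rt u v"

definition children :: "'a pair_pre_digraph \<Rightarrow> 'a \<Rightarrow> 'a \<Rightarrow> 'a set" where
  "children T rt u = {v. parent T rt u v}"

definition leaves :: "'a pair_pre_digraph \<Rightarrow> 'a \<Rightarrow> 'a set" where
  "leaves T rt = {v \<in> pverts T. children T rt v = {}}"

text \<open>With unit arc weights, \<^const>\<open>wf_digraph.\<mu>\<close> is the usual graph distance.\<close>

definition complete_dary_tree :: "nat \<Rightarrow> nat \<Rightarrow> 'a pair_pre_digraph \<Rightarrow> 'a \<Rightarrow> bool" where
  "complete_dary_tree d m T rt \<longleftrightarrow> rooted_tree T rt \<and>
     (\<forall>v \<in> pverts T - leaves T rt. card (children T rt v) = d) \<and>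
     (\<forall>l \<in> leaves T rt. wf_digraph.\<mu> (with_proj T) (\<lambda>_. 1) rt l = ereal (real m))"

text \<open>
  \<open>A l\<close> is the set of ends, other than \<open>l\<close>, of the augmenting edges at the leaf \<open>l\<close>. Excluding the
  parent makes these edges additional to those of the underlying tree.
\<close>

definition augmented_tree ::
    "nat \<Rightarrow> 'a pair_pre_digraph \<Rightarrow> 'a pair_pre_digraph \<Rightarrow> 'a \<Rightarrow> bool" where
  "augmented_tree r G T rt \<longleftrightarrow> rooted_tree T rt \<and> pverts G = pverts T \<and>
     (\<exists>A. (\<forall>l \<in> leaves T rt. card (A l) = r \<and>
             A l \<subseteq> {a. ancestor T rt a l \<and> \<not> parent T rt a l}) \<and>
          parcs G = parcs T \<union> (\<Union>l \<in> leaves T rt. \<Union>a \<in> A l. {(l, a), (a, l)}))"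

definition drg_graph :: "nat \<Rightarrow> nat \<Rightarrow> nat \<Rightarrow> 'a pair_pre_digraph \<Rightarrow> bool" where
  "drg_graph d r g G \<longleftrightarrow> pair_graph G \<and>
     (\<exists>T rt m. complete_dary_tree d m T rt \<and> augmented_tree r G T rt) \<and>
     bipartite G \<and> enat g \<le> girth G"

end

theory Submission
  imports Defs "HOL-Library.Sublist" "HOL-Library.Countable"
begin

text \<open>
  The vertices of the underlying tree are the words of length at most \<open>m\<close> over \<open>d\<close> letters,
  ordered by prefix. An augmentation is then a function \<open>f\<close> that assigns to each leaf \<open>l\<close> (a word
  of length \<open>m\<close>) the set of lengths of those prefixes to which \<open>l\<close> is joined. If \<open>m\<close> is even and all
  these lengths are odd and smaller than \<open>m - 1\<close>, then every edge changes the parity of the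
  length, so that the graph is bipartite, and no leaf is joined to its parent.

  Such an \<open>f\<close> with \<open>r\<close> values at every leaf and girth at least \<open>g\<close> is found by induction on \<open>g\<close>
  and, for fixed \<open>g\<close>, on \<open>r\<close> (\<open>depth_choice_exists\<close>). For girth bound 0 any choice will do, and
  for \<open>r = 0\<close> the graph is a tree. For the step to \<open>(r + 1, g + 1)\<close>, take a lower graph for
  \<open>(r, g + 1)\<close>, of height \<open>m1\<close> say, which has \<open>N = d ^ m1\<close> leaves, and an upper graph for
  \<open>(N, g)\<close>, which the hypothesis on \<open>g\<close> supplies however large \<open>N\<close> is. Hang a copy of the lower
  graph below every leaf of the upper graph, and distribute the \<open>N\<close> augmenting edges of that leaf
  over the \<open>N\<close> leaves of the copy, one for each.

  A cycle inside one copy has length at least \<open>g + 1\<close>. Any other cycle contains an edge outside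
  the copies. Contracting each copy to a point turns it into a closed walk of the upper graph that
  uses no edge twice, because contraction is injective on the edges outside the copies. So this
  closed walk has length at least \<open>g\<close>. The cycle itself is strictly longer: like every cycle it
  visits a leaf, and only one edge at a leaf of a copy lies outside the copy, so that the cycle has
  an edge inside a copy, which the contraction loses (\<open>girth_glued\<close>).

  What remains is to encode words as natural numbers and to read off the tree structure, the root
  distance and the girth of the resulting graph.
\<close>

section \<open>Cycles and walks that avoid an edge\<close>

text \<open>
  A cycle of length \<open>n\<close> is represented as an \<open>n\<close>-periodic sequence, so that no position on it is
  distinguished and successors need no wrap-around.
\<close>

definition closed_cycle :: "('a \<times> 'a) set \<Rightarrow> nat \<Rightarrow> (nat \<Rightarrow> 'a) \<Rightarrow> bool" where
  "closed_cycle E n c \<longleftrightarrow> 3 \<le> n \<and> (\<forall>i. c (i + n) = c i) \<and> inj_on c {..<n} \<and>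
     (\<forall>i. (c i, c (Suc i)) \<in> E)"

definition girth_at_least :: "('a \<times> 'a) set \<Rightarrow> nat \<Rightarrow> bool" where
  "girth_at_least E g \<longleftrightarrow> (\<forall>n c. closed_cycle E n c \<longrightarrow> g \<le> n)"

lemma closed_cycle_eq_iff:
  assumes "closed_cycle E n c"
  shows "c i = c j \<longleftrightarrow> i mod n = j mod n"
proof -
  have "c (i mod n + k * n) = c (i mod n)" for i k
    using assms unfolding closed_cycle_def
    by (induction k) (simp_all add: add.assoc[symmetric] add.commute[of n])
  then have "c i = c (i mod n)" for i
    by (metis mod_div_decomp add.commute)
  moreover have "i mod n \<in> {..<n}" for i
    using assms unfolding closed_cycle_def by simp
  ultimately show ?thesis
    using assms unfolding closed_cycle_def inj_on_def by metis
qed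

text \<open>
  The form in which the girth of the upper graph is used. The contraction of a cycle may repeat
  vertices and so need not be a cycle, but it does not repeat edges: cut open at one of its edges, it
  is a walk between the ends of that edge that avoids the edge. A shortest such walk has distinct
  vertices and is closed to a cycle by the edge.
\<close>

lemma walk_avoiding_edge_bound:
  assumes girth: "girth_at_least E g" and irrefl: "u \<noteq> v" and "(v, u) \<in> E"
    and walk: "(u, v) \<in> (E - {(u, v), (v, u)}) ^^ n"
  shows "g \<le> Suc n"
proof -
  let ?R = "E - {(u, v), (v, u)}"
  define k where "k = (LEAST k. (u, v) \<in> ?R ^^ k)"
  have k: "(u, v) \<in> ?R ^^ k" and min: "\<And>j. (u, v) \<in> ?R ^^ j \<Longrightarrow> k \<le> j"
    unfolding k_def using walk by (auto intro: LeastI Least_le)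
  from k obtain s where s: "s 0 = u" "s k = v" "\<And>i. i < k \<Longrightarrow> (s i, s (Suc i)) \<in> ?R"
    unfolding relpow_fun_conv by auto
  have seg: "(s i, s (i + j)) \<in> ?R ^^ j" if "i + j \<le> k" for i j
    using that
  proof (induction j)
    case (Suc j)
    then show ?case using s(3)[of "i + j"] relpow_Suc_I[of "s i" "s (i + j)" j ?R] by simp
  qed simp
  have "inj_on s {..k}"
  proof (rule linorder_inj_onI')
    fix i j assume ij: "i \<in> {..k}" "j \<in> {..k}" "i < j"
    show "s i \<noteq> s j"
    proof
      assume eq: "s i = s j"
      have "(s 0, s i) \<in> ?R ^^ i" "(s j, s k) \<in> ?R ^^ (k - j)"
        using seg[of 0 i] seg[of j "k - j"] ij by auto
      then have "(u, v) \<in> ?R ^^ (i + (k - j))"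
        unfolding relpow_add using s(1,2) eq by auto
      from min[OF this] show False using ij by simp
    qed
  qed
  moreover have "k \<noteq> 0" using s irrefl by metis
  moreover have "k \<noteq> 1" using s(3)[of 0] s(1,2) by auto
  moreover have "(s (i mod Suc k), s (Suc i mod Suc k)) \<in> E" for i
    using s(1,2) s(3)[of "i mod Suc k"] \<open>(v, u) \<in> E\<close> mod_less_divisor[of "Suc k" i]
    by (auto simp: mod_Suc less_Suc_eq simp del: mod_less_divisor)
  moreover have "inj_on (\<lambda>i. s (i mod Suc k)) {..<Suc k}"
    using \<open>inj_on s {..k}\<close> by (simp add: inj_on_def)
  ultimately have "closed_cycle E (Suc k) (\<lambda>i. s (i mod Suc k))"
    unfolding closed_cycle_def by (simp only: mod_add_self2) simp
  then have "g \<le> Suc k" using girth unfolding girth_at_least_def by blast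
  with min[OF walk] show ?thesis by simp
qed

text \<open>
  The contraction of a walk stands still at each edge that is contracted, and is shorter than the
  walk as soon as this happens once.
\<close>

lemma lazy_walk_relpow:
  fixes s :: "nat \<Rightarrow> 'a"
  assumes "\<And>i. i < n \<Longrightarrow> s i = s (Suc i) \<or> (s i, s (Suc i)) \<in> R"
  shows "\<exists>k \<le> n. (s 0, s n) \<in> R ^^ k \<and> ((\<exists>i < n. s i = s (Suc i)) \<longrightarrow> k < n)"
  using assms
proof (induction n)
  case 0
  then show ?case by simp
next
  case (Suc n)
  then obtain k where k: "k \<le> n" "(s 0, s n) \<in> R ^^ k"
    "(\<exists>i < n. s i = s (Suc i)) \<longrightarrow> k < n" by (metis less_SucI)
  show ?case
  proof (cases "s n = s (Suc n)")
    case True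
    then show ?thesis using k by (intro exI[of _ k]) auto
  next
    case False
    then have "(s 0, s (Suc n)) \<in> R ^^ Suc k" using k Suc.prems[of n] by auto
    then show ?thesis using k False by (intro exI[of _ "Suc k"]) (auto simp: less_Suc_eq)
  qed
qed

section \<open>Words with edges from leaves to prefixes\<close>

definition words :: "nat \<Rightarrow> nat \<Rightarrow> nat list set" where
  "words d m = {w. set w \<subseteq> {..<d} \<and> length w \<le> m}"

text \<open>
  The edges are oriented from the longer word to the shorter. The case \<open>f = (\<lambda>_. {})\<close> is the bare
  tree.
\<close>

definition up :: "nat \<Rightarrow> nat \<Rightarrow> (nat list \<Rightarrow> nat set) \<Rightarrow> (nat list \<times> nat list) set" where
  "up d m f = {(w, y). w \<in> words d m \<and> strict_prefix y w \<and>
     (Suc (length y) = length w \<or> length w = m \<and> length y \<in> f w)}"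

definition edges :: "nat \<Rightarrow> nat \<Rightarrow> (nat list \<Rightarrow> nat set) \<Rightarrow> (nat list \<times> nat list) set" where
  "edges d m f = up d m f \<union> (up d m f)\<inverse>"

text \<open>
  The parities make the graph bipartite, and \<open>Suc j < m\<close> keeps leaves from being joined to their
  parents.
\<close>

definition depth_choice :: "nat \<Rightarrow> nat \<Rightarrow> nat \<Rightarrow> (nat list \<Rightarrow> nat set) \<Rightarrow> bool" where
  "depth_choice d r m f \<longleftrightarrow> 0 < m \<and> even m \<and>
     (\<forall>l. set l \<subseteq> {..<d} \<and> length l = m \<longrightarrow>
        f l \<subseteq> {j. odd j \<and> Suc j < m} \<and> card (f l) = r)"

lemma strict_prefix_take_iff: "strict_prefix y w \<longleftrightarrow> length y < length w \<and> take (length y) w = y"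
  by (metis append_eq_conv_conj append_take_drop_id prefix_def prefix_length_less
      prefix_order.dual_order.strict_iff_order less_irrefl strict_prefixI')

lemma up_shorter: "(w, y) \<in> up d m f \<Longrightarrow> length y < length w"
  unfolding up_def by (auto dest: prefix_length_less)

lemma edges_length_neq: "(x, y) \<in> edges d m f \<Longrightarrow> length x \<noteq> length y"
  unfolding edges_def by (auto dest: up_shorter)

lemma edges_sym: "(x, y) \<in> edges d m f \<longleftrightarrow> (y, x) \<in> edges d m f"
  unfolding edges_def by auto

lemma edges_length_le: "(x, y) \<in> edges d m f \<Longrightarrow> length x \<le> m"
  unfolding edges_def up_def words_def by (auto dest: prefix_length_less)

text \<open>
  At a longest word on the cycle both edges go upwards, to two different prefixes. Only a leaf with
  an augmenting edge has more than one upward edge.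
\<close>

lemma closed_cycle_visits_leaf:
  assumes "closed_cycle (edges d m f) n c"
  obtains k where "length (c (Suc k)) = m" "f (c (Suc k)) \<noteq> {}" "c k \<noteq> c (Suc (Suc k))"
    "(c (Suc k), c k) \<in> up d m f" "(c (Suc k), c (Suc (Suc k))) \<in> up d m f"
proof -
  have adj: "\<And>i. (c i, c (Suc i)) \<in> edges d m f" and n: "3 \<le> n" and per: "\<And>i. c (i + n) = c i"
    using assms unfolding closed_cycle_def by auto
  have fin: "finite (range (\<lambda>i. length (c i)))"
    by (rule finite_subset[of _ "{..m}"]) (use adj edges_length_le in fastforce)+
  obtain i where i: "\<And>j. length (c j) \<le> length (c i)"
    using Max_in[OF fin] Max_ge[OF fin]
    by (metis (mono_tags, lifting) empty_not_UNIV image_iff image_is_empty rangeI)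
  \<comment> \<open>Going once around the cycle gives \<open>i\<close> a predecessor even if it is 0.\<close>
  obtain k where k: "i + n = Suc k" using n by (metis add_Suc_right Suc_le_D numeral_3_eq_3)
  have max: "\<And>j. length (c j) \<le> length (c (Suc k))" using i per[of i] k by simp
  have "(c (Suc k), c k) \<in> up d m f"
    using adj[of k] max[of k] up_shorter[of "c k" "c (Suc k)" d m f] unfolding edges_def by auto
  moreover have "(c (Suc k), c (Suc (Suc k))) \<in> up d m f"
    using adj[of "Suc k"] max[of "Suc (Suc k)"] up_shorter[of "c (Suc (Suc k))" "c (Suc k)" d m f]
    unfolding edges_def by auto
  moreover have "c k \<noteq> c (Suc (Suc k))"
  proof -
    have "k mod n \<noteq> Suc (Suc k) mod n" using n by (auto simp: mod_Suc)
    then show ?thesis using closed_cycle_eq_iff[OF assms] by simp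
  qed
  moreover from calculation have "length (c (Suc k)) = m \<and> f (c (Suc k)) \<noteq> {}"
    unfolding up_def strict_prefix_take_iff by auto (metis Suc_inject)+
  ultimately show thesis using that by blast
qed

lemma girth_at_least_tree: "girth_at_least (edges d m (\<lambda>_. {})) g"
  unfolding girth_at_least_def using closed_cycle_visits_leaf by blast

section \<open>Hanging copies of one graph below the leaves of another\<close>

text \<open>
  The leaf \<open>w\<close> of the copy below the upper leaf \<open>l\<close> takes over the augmenting edge of \<open>l\<close> to depth
  \<open>\<phi> l w\<close>. A word splits into its position \<open>take m0\<close> in the upper graph and its position \<open>drop m0\<close>
  in the copy, so that \<open>take m0\<close> is the contraction of the copies.
\<close>

locale gluing =
  fixes d r N m0 m1 :: nat and f0 f1 :: "nat list \<Rightarrow> nat set"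
    and \<phi> :: "nat list \<Rightarrow> nat list \<Rightarrow> nat"
  assumes upper: "depth_choice d N m0 f0" and lower: "depth_choice d r m1 f1"
    and \<phi>_in: "\<And>l w. set l \<subseteq> {..<d} \<Longrightarrow> length l = m0 \<Longrightarrow> set w \<subseteq> {..<d} \<Longrightarrow> length w = m1 \<Longrightarrow>
        \<phi> l w \<in> f0 l"
    and \<phi>_inj: "\<And>l. set l \<subseteq> {..<d} \<Longrightarrow> length l = m0 \<Longrightarrow>
        inj_on (\<phi> l) {w. set w \<subseteq> {..<d} \<and> length w = m1}"
begin

definition glued :: "nat list \<Rightarrow> nat set" where
  "glued w = insert (\<phi> (take m0 w) (drop m0 w)) ((+) m0 ` f1 (drop m0 w))"

abbreviation "E \<equiv> edges d (m0 + m1) glued"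

lemma m1_pos: "0 < m1"
  using lower unfolding depth_choice_def by simp

lemma \<phi>_leaf:
  assumes "set w \<subseteq> {..<d}" "length w = m0 + m1"
  shows "\<phi> (take m0 w) (drop m0 w) \<in> f0 (take m0 w)"
    and "Suc (\<phi> (take m0 w) (drop m0 w)) < m0" and "odd (\<phi> (take m0 w) (drop m0 w))"
proof -
  have *: "set (take m0 w) \<subseteq> {..<d}" "set (drop m0 w) \<subseteq> {..<d}"
    using assms by (meson order_trans set_take_subset set_drop_subset)+
  then show "\<phi> (take m0 w) (drop m0 w) \<in> f0 (take m0 w)"
    using \<phi>_in assms by simp
  moreover have "f0 (take m0 w) \<subseteq> {j. odd j \<and> Suc j < m0}"
    using upper * assms unfolding depth_choice_def by simp
  ultimately show "Suc (\<phi> (take m0 w) (drop m0 w)) < m0" "odd (\<phi> (take m0 w) (drop m0 w))"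
    by auto
qed

lemma depth_choice_glued: "depth_choice d (Suc r) (m0 + m1) glued"
  unfolding depth_choice_def
proof (intro conjI allI impI)
  show "0 < m0 + m1" "even (m0 + m1)"
    using upper lower unfolding depth_choice_def by auto
  fix l :: "nat list" assume l: "set l \<subseteq> {..<d} \<and> length l = m0 + m1"
  then have "set (drop m0 l) \<subseteq> {..<d}" by (meson order_trans set_drop_subset)
  then have f1: "f1 (drop m0 l) \<subseteq> {j. odd j \<and> Suc j < m1}" "card (f1 (drop m0 l)) = r"
    using lower l unfolding depth_choice_def by simp_all
  have "even m0" using upper unfolding depth_choice_def by simp
  show "glued l \<subseteq> {j. odd j \<and> Suc j < m0 + m1}"
    using f1 \<phi>_leaf[of l] l \<open>even m0\<close> unfolding glued_def by auto
  have "finite (f1 (drop m0 l))" using f1(1)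
    by (rule finite_subset) (simp add: finite_subset[of _ "{..<m1}"] subset_eq)
  moreover have "\<phi> (take m0 l) (drop m0 l) \<notin> (+) m0 ` f1 (drop m0 l)"
    using \<phi>_leaf(2)[of l] l by auto
  ultimately show "card (glued l) = Suc r"
    unfolding glued_def using f1(2) by (simp add: card_image)
qed

lemma up_project_upper:
  assumes "(w, y) \<in> up d (m0 + m1) glued" "length y < m0"
  shows "(take m0 w, y) \<in> up d m0 f0"
proof -
  have w: "set w \<subseteq> {..<d}" "length w \<le> m0 + m1" "length y < length w" "take (length y) w = y"
    "Suc (length y) = length w \<or> length w = m0 + m1 \<and> length y \<in> glued w"
    using assms unfolding up_def words_def strict_prefix_take_iff by auto
  have t: "set (take m0 w) \<subseteq> {..<d}" using w(1) by (meson order_trans set_take_subset)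
  from w(5) show ?thesis
  proof
    assume "Suc (length y) = length w"
    then show ?thesis using w assms unfolding up_def words_def strict_prefix_take_iff by simp
  next
    assume *: "length w = m0 + m1 \<and> length y \<in> glued w"
    then have "length y = \<phi> (take m0 w) (drop m0 w)" using assms(2) unfolding glued_def by auto
    then have "length y \<in> f0 (take m0 w)" using \<phi>_leaf(1) w * by simp
    then show ?thesis using w assms t * unfolding up_def words_def strict_prefix_take_iff
      by (simp add: min_def)
  qed
qed

text \<open>
  Contraction is injective on edges that leave a copy. Two augmenting edges at the same upper leaf
  come from different leaves of the copy and have different depths by injectivity of \<open>\<phi> l\<close>. An
  augmenting edge cannot collide with the tree edge above the copy, because it does not end at the
  parent.
\<close>

lemma up_inj_upper:
  assumes "(w, y) \<in> up d (m0 + m1) glued" "(w', y) \<in> up d (m0 + m1) glued" "length y < m0"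
    and eq: "take m0 w = take m0 w'"
  shows "w = w'"
proof -
  have cases: "take m0 x = x \<or>
      set x \<subseteq> {..<d} \<and> length x = m0 + m1 \<and> length y = \<phi> (take m0 x) (drop m0 x)"
    "Suc (length y) = length x \<or>
      set x \<subseteq> {..<d} \<and> length x = m0 + m1 \<and> length y = \<phi> (take m0 x) (drop m0 x)"
    if "(x, y) \<in> up d (m0 + m1) glued" for x
    using that assms(3) unfolding up_def words_def glued_def by auto
  have mixed: False if x: "Suc (length y) = length (take m0 x')" "set x' \<subseteq> {..<d}"
    "length x' = m0 + m1" "length y = \<phi> (take m0 x') (drop m0 x')" for x'
    using x \<phi>_leaf(2)[of x'] by simp
  show ?thesis
  proof (cases "Suc (length y) = length w \<or> Suc (length y) = length w'")
    case True
    then show ?thesis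
      using cases[OF assms(1)] cases[OF assms(2)] mixed[of w] mixed[of w'] eq assms(3)
      by (metis Suc_leI take_all)
  next
    case False
    then have l: "set w \<subseteq> {..<d}" "length w = m0 + m1" "length y = \<phi> (take m0 w) (drop m0 w)"
      "set w' \<subseteq> {..<d}" "length w' = m0 + m1" "length y = \<phi> (take m0 w') (drop m0 w')"
      using cases(2)[OF assms(1)] cases(2)[OF assms(2)] by auto
    have "set (take m0 w) \<subseteq> {..<d}" "set (drop m0 w) \<subseteq> {..<d}" "set (drop m0 w') \<subseteq> {..<d}"
      using l by (meson order_trans set_take_subset set_drop_subset)+
    then have "drop m0 w = drop m0 w'"
      using \<phi>_inj[of "take m0 w"] l eq unfolding inj_on_def by simp
    then show ?thesis using eq by (metis append_take_drop_id)
  qed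
qed

lemma up_lower:
  assumes "(w, y) \<in> up d (m0 + m1) glued" "m0 \<le> length y"
  shows "take m0 w = take m0 y" and "(drop m0 w, drop m0 y) \<in> up d m1 f1"
proof -
  have w: "set w \<subseteq> {..<d}" "length w \<le> m0 + m1" "length y < length w" "take (length y) w = y"
    "Suc (length y) = length w \<or> length w = m0 + m1 \<and> length y \<in> glued w"
    using assms unfolding up_def words_def strict_prefix_take_iff by auto
  show "take m0 w = take m0 y" using assms(2) w(4) by (metis min.absorb1 take_take)
  have "set (drop m0 w) \<subseteq> {..<d}" using w(1) by (meson order_trans set_drop_subset)
  moreover have "take (length y - m0) (drop m0 w) = drop m0 y"
    using w(4) assms(2) by (metis drop_take)
  moreover have "length y - m0 \<in> f1 (drop m0 w)" if "length w = m0 + m1" "length y \<in> glued w"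
    using that \<phi>_leaf(2)[of w] w(1) assms(2) unfolding glued_def by auto
  ultimately show "(drop m0 w, drop m0 y) \<in> up d m1 f1"
    using w assms unfolding up_def words_def strict_prefix_take_iff by auto
qed

lemma up_leaf_upper_unique:
  assumes "(w, y) \<in> up d (m0 + m1) glued" "(w, y') \<in> up d (m0 + m1) glued" "length w = m0 + m1"
    and "length y < m0" "length y' < m0"
  shows "y = y'"
proof -
  have "length y = length y'"
    using assms m1_pos unfolding up_def glued_def by auto
  then show ?thesis using assms unfolding up_def strict_prefix_take_iff by auto
qed

lemma edge_inside_copy:
  assumes "(x, y) \<in> E" "m0 \<le> length x" "m0 \<le> length y"
  shows "take m0 x = take m0 y" and "(drop m0 x, drop m0 y) \<in> edges d m1 f1"
  using assms up_lower unfolding edges_def by auto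

lemma edge_outside_copies:
  assumes "(x, y) \<in> E" "length x < m0 \<or> length y < m0"
  shows "(take m0 x, take m0 y) \<in> edges d m0 f0"
proof -
  have *: "(take m0 w, take m0 z) \<in> up d m0 f0"
    if "(w, z) \<in> up d (m0 + m1) glued" "length w < m0 \<or> length z < m0" for w z
    using up_project_upper[OF that(1)] up_shorter[OF that(1)] that(2) by auto
  show ?thesis using assms * unfolding edges_def by blast
qed

lemma edge_outside_copies_inj:
  assumes "(x, y) \<in> E" "length x < m0 \<or> length y < m0"
    and "(x', y') \<in> E" "length x' < m0 \<or> length y' < m0"
    and eq: "{take m0 x, take m0 y} = {take m0 x', take m0 y'}"
  shows "{x, y} = {x', y'}"
proof -
  have orient: "\<exists>w z. {x, y} = {w, z} \<and> {take m0 x, take m0 y} = {take m0 w, z} \<and>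
      (w, z) \<in> up d (m0 + m1) glued \<and> length z < m0 \<and> length z < length (take m0 w)"
    if xy: "(x, y) \<in> E" "length x < m0 \<or> length y < m0" for x y
  proof -
    have *: "length z < m0 \<and> take m0 z = z \<and> length z < length (take m0 w)"
      if "(w, z) \<in> up d (m0 + m1) glued" "length w < m0 \<or> length z < m0" for w z
      using up_shorter[OF that(1)] that(2) by auto
    show ?thesis
    proof (cases "(x, y) \<in> up d (m0 + m1) glued")
      case True
      then show ?thesis using *[of x y] xy by (intro exI[of _ x] exI[of _ y]) auto
    next
      case False
      then have "(y, x) \<in> up d (m0 + m1) glued" using xy unfolding edges_def by auto
      then show ?thesis using *[of y x] xy by (intro exI[of _ y] exI[of _ x]) auto
    qed
  qed
  obtain w z where wz: "{x, y} = {w, z}" "{take m0 x, take m0 y} = {take m0 w, z}"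
    "(w, z) \<in> up d (m0 + m1) glued" "length z < m0" "length z < length (take m0 w)"
    using orient[OF assms(1,2)] by blast
  obtain w' z' where wz': "{x', y'} = {w', z'}" "{take m0 x', take m0 y'} = {take m0 w', z'}"
    "(w', z') \<in> up d (m0 + m1) glued" "length z' < length (take m0 w')"
    using orient[OF assms(3,4)] by blast
  have "z = z'" "take m0 w = take m0 w'"
    using eq wz(2,5) wz'(2,4) by (auto simp: doubleton_eq_iff)
  then show ?thesis using up_inj_upper wz wz' by metis
qed

text \<open>
  The cycle is either contained in one copy, where \<open>drop m0\<close> makes it a cycle of the lower graph, or
  it passes above the copies at some \<open>c a\<close>. In the second case it is cut open at the edge from
  \<open>c a\<close> to \<open>c (Suc a)\<close>, and its remaining \<open>n - 1\<close> edges are contracted to a walk of the upper graph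
  with at most \<open>n - 2\<close> edges, since at least one edge lies inside a copy.
\<close>

lemma girth_glued:
  assumes upper_girth: "girth_at_least (edges d m0 f0) g"
    and lower_girth: "girth_at_least (edges d m1 f1) (Suc g)"
  shows "girth_at_least E (Suc g)"
  unfolding girth_at_least_def
proof (intro allI impI)
  fix n c assume c: "closed_cycle E n c"
  have n: "3 \<le> n" and adj: "\<And>i. (c i, c (Suc i)) \<in> E" and per: "\<And>i. c (i + n) = c i"
    using c unfolding closed_cycle_def by auto
  show "Suc g \<le> n"
  proof (cases "\<forall>i. m0 \<le> length (c i)")
    case True
    have step: "take m0 (c i) = take m0 (c (Suc i))" for i
      using edge_inside_copy(1)[OF adj] True by blast
    have const: "take m0 (c i) = take m0 (c 0)" for i
      by (induction i) (use step in auto)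
    have "inj_on (\<lambda>i. drop m0 (c i)) {..<n}"
      using c const unfolding closed_cycle_def inj_on_def by (metis append_take_drop_id)
    then have "closed_cycle (edges d m1 f1) n (\<lambda>i. drop m0 (c i))"
      using n per edge_inside_copy(2)[OF adj] True unfolding closed_cycle_def by simp
    then show ?thesis using lower_girth unfolding girth_at_least_def by blast
  next
    case False
    then obtain a where a: "length (c a) < m0" by (auto simp: not_le)
    \<comment> \<open>At a leaf on the cycle at most one of the two edges leaves the copy.\<close>
    obtain b where b: "m0 \<le> length (c b)" "m0 \<le> length (c (Suc b))"
    proof -
      obtain k where k: "length (c (Suc k)) = m0 + m1" "c k \<noteq> c (Suc (Suc k))"
        "(c (Suc k), c k) \<in> up d (m0 + m1) glued" "(c (Suc k), c (Suc (Suc k))) \<in> up d (m0 + m1) glued"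
        using closed_cycle_visits_leaf[OF c] by blast
      then have "m0 \<le> length (c k) \<or> m0 \<le> length (c (Suc (Suc k)))"
        using up_leaf_upper_unique by (meson not_le)
      then show ?thesis using that[of k] that[of "Suc k"] k(1) by auto
    qed
    let ?s = "\<lambda>i. take m0 (c (i + Suc a))"
    let ?u = "take m0 (c (Suc a))" and ?v = "take m0 (c a)"
    let ?R = "edges d m0 f0 - {(?u, ?v), (?v, ?u)}"
    have step: "?s i = ?s (Suc i) \<or> (?s i, ?s (Suc i)) \<in> ?R" if i: "i < n - 1" for i
    proof (cases "m0 \<le> length (c (i + Suc a)) \<and> m0 \<le> length (c (Suc (i + Suc a)))")
      case True
      then show ?thesis using edge_inside_copy(1)[OF adj[of "i + Suc a"]] by simp
    next
      case False
      then have out: "length (c (i + Suc a)) < m0 \<or> length (c (Suc (i + Suc a))) < m0" by auto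
      have ne: "c (i + Suc a) \<noteq> c a" 
      proof
        assume "c (i + Suc a) = c a"
        then have "n dvd i + Suc a - a"
          using closed_cycle_eq_iff[OF c] mod_eq_dvd_iff_nat[of a "i + Suc a" n] by simp
        then show False using i by (auto dest: dvd_imp_le)
      qed
      have "{c (i + Suc a), c (Suc (i + Suc a))} \<noteq> {c a, c (Suc a)}"
      proof
        assume "{c (i + Suc a), c (Suc (i + Suc a))} = {c a, c (Suc a)}"
        then have "c (i + Suc a) = c (Suc a)" "c (Suc (i + Suc a)) = c a"
          using ne by (auto simp: doubleton_eq_iff)
        then have "(i + Suc a) mod n = Suc a mod n" "Suc (i + Suc a) mod n = a mod n"
          using closed_cycle_eq_iff[OF c] by blast+
        then have "n dvd i" "n dvd i + 2"
          by (simp_all add: mod_eq_dvd_iff_nat)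
        \<comment> \<open>Reversing an edge would take a cycle of length two.\<close>
        then have "n dvd 2" by (metis dvd_add_right_iff)
        then show False using n by (auto dest: dvd_imp_le)
      qed
      then have "{?s i, ?s (Suc i)} \<noteq> {?v, ?u}"
        using edge_outside_copies_inj[OF adj[of "i + Suc a"] out adj[of a]] a by auto
      then show ?thesis
        using edge_outside_copies[OF adj[of "i + Suc a"] out] by (auto simp: doubleton_eq_iff)
    qed
    have s_end: "?s (n - 1) = ?v" using n per[of a] by (simp add: add.commute)
    have stationary: "\<exists>i < n - 1. ?s i = ?s (Suc i)"
    proof -
      \<comment> \<open>The position of \<open>b\<close> counted from \<open>Suc a\<close>: since \<open>n - 1\<close> is \<open>-1\<close> modulo \<open>n\<close>, this is
        \<open>b - Suc a\<close> modulo \<open>n\<close>.\<close>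
      define i where "i = (b + (n - 1) * Suc a) mod n"
      have "b + (n - 1) * Suc a + Suc a = b + n * Suc a"
        using n by (cases n) auto
      then have "(i + Suc a) mod n = (b + n * Suc a) mod n"
        unfolding i_def by (metis mod_add_left_eq)
      then have eq: "(i + Suc a) mod n = b mod n" by (simp only: mod_mult_self2)
      then have ci: "c (i + Suc a) = c b" using closed_cycle_eq_iff[OF c] by blast
      moreover have cSi: "c (Suc i + Suc a) = c (Suc b)"
        using eq closed_cycle_eq_iff[OF c] by (simp add: mod_Suc)
      ultimately have "?s i = ?s (Suc i)"
        using edge_inside_copy(1)[OF adj b] by simp
      moreover have "i < n" unfolding i_def using n by simp
      moreover have "i \<noteq> n - 1"
        using ci b(1) a per[of a] n by (auto simp: add.commute)
      ultimately show ?thesis by (intro exI[of _ i]) auto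
    qed
    obtain k where k: "k < n - 1" "(?u, ?v) \<in> ?R ^^ k"
      using lazy_walk_relpow[of "n - 1" ?s ?R] step stationary s_end by auto
    have vu: "(?v, ?u) \<in> edges d m0 f0"
      using edge_outside_copies[OF adj[of a]] a by simp
    then have "?u \<noteq> ?v" using edges_length_neq by fastforce
    from walk_avoiding_edge_bound[OF upper_girth this vu k(2)] k(1) show ?thesis by simp
  qed
qed

end

section \<open>Existence of augmentations of large girth\<close>

lemma card_words_length: "card {w. set w \<subseteq> {..<d} \<and> length w = m} = d ^ m"
  using card_lists_length_eq[of "{..<d}" m] by simp

text \<open>
  The induction on \<open>g\<close> must hold for all \<open>r\<close> at once: the upper graph needs as many augmenting
  edges at each leaf as the lower graph has leaves.
\<close>

lemma depth_choice_exists: "\<exists>m f. depth_choice d r m f \<and> girth_at_least (edges d m f) g"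
proof (induction g arbitrary: r)
  case 0
  have "depth_choice d r (2 * r + 2) (\<lambda>_. (\<lambda>i. 2 * i + 1) ` {..<r})"
    unfolding depth_choice_def by (auto simp: card_image inj_on_def)
  moreover have "girth_at_least E 0" for E :: "(nat list \<times> nat list) set"
    unfolding girth_at_least_def by simp
  ultimately show ?case by (intro exI conjI)
next
  case (Suc g)
  show ?case
  proof (induction r)
    case 0
    have "depth_choice d 0 2 (\<lambda>_. {})" unfolding depth_choice_def by simp
    then show ?case using girth_at_least_tree by (intro exI conjI)
  next
    case (Suc r)
    then obtain m1 f1 where 1: "depth_choice d r m1 f1" "girth_at_least (edges d m1 f1) (Suc g)"
      by blast
    let ?L = "{w. set w \<subseteq> {..<d} \<and> length w = m1}"
    obtain m0 f0 where 0: "depth_choice d (d ^ m1) m0 f0" "girth_at_least (edges d m0 f0) g"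
      using \<open>\<And>r. \<exists>m f. depth_choice d r m f \<and> girth_at_least (edges d m f) g\<close> by blast
    have distribute: "\<exists>h. inj_on h ?L \<and> h ` ?L \<subseteq> f0 l" if l: "set l \<subseteq> {..<d}" "length l = m0" for l
    proof -
      have "f0 l \<subseteq> {j. odd j \<and> Suc j < m0}" "card (f0 l) = d ^ m1"
        using 0(1) l unfolding depth_choice_def by simp_all
      moreover from this(1) have "finite (f0 l)"
        by (rule finite_subset) (rule finite_subset[of _ "{..<m0}"], auto)
      moreover have "finite ?L" using finite_lists_length_eq[of "{..<d}" m1] by simp
      ultimately show ?thesis
        using card_le_inj[of ?L "f0 l"] card_words_length[of d m1] by auto
    qed
    define \<phi> where "\<phi> l = (SOME h. inj_on h ?L \<and> h ` ?L \<subseteq> f0 l)" for l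
    have \<phi>: "inj_on (\<phi> l) ?L" "\<phi> l ` ?L \<subseteq> f0 l" if "set l \<subseteq> {..<d}" "length l = m0" for l
      using someI_ex[OF distribute[OF that]] unfolding \<phi>_def by simp_all
    interpret gluing d r "d ^ m1" m0 m1 f0 f1 \<phi>
    proof
      show "depth_choice d (d ^ m1) m0 f0" "depth_choice d r m1 f1"
        by (fact 0(1) 1(1))+
      show "\<phi> l w \<in> f0 l" if "set l \<subseteq> {..<d}" "length l = m0" "set w \<subseteq> {..<d}" "length w = m1" for l w
        using \<phi>(2)[OF that(1,2)] that(3,4) by auto
      show "inj_on (\<phi> l) ?L" if "set l \<subseteq> {..<d}" "length l = m0" for l
        using \<phi>(1)[OF that] .
    qed
    show ?case using depth_choice_glued girth_glued[OF 0(2) 1(2)] by (intro exI conjI)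
  qed
qed

section \<open>The tree of words as a graph\<close>

lemma finite_words: "finite (words d m)"
  unfolding words_def using finite_lists_length_le[of "{..<d}" m] by simp

lemma Nil_in_words: "[] \<in> words d m"
  unfolding words_def by simp

lemma prefix_in_words: "w \<in> words d m \<Longrightarrow> prefix y w \<Longrightarrow> y \<in> words d m"
  unfolding words_def by (auto dest: prefix_length_le set_mono_prefix)

lemma edges_in_words: "edges d m f \<subseteq> words d m \<times> words d m"
  unfolding edges_def up_def by (auto intro: prefix_in_words dest: prefix_order.less_imp_le)

lemma snoc_in_words_iff: "w @ [x] \<in> words d m \<longleftrightarrow> w \<in> words d m \<and> x < d \<and> length w < m"
  unfolding words_def by auto

lemma up_tree_iff: "(w, y) \<in> up d m (\<lambda>_. {}) \<longleftrightarrow> w \<in> words d m \<and> (\<exists>x. w = y @ [x])"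
proof -
  have "strict_prefix y w \<and> Suc (length y) = length w \<longleftrightarrow> (\<exists>x. w = y @ [x])"
    unfolding strict_prefix_def prefix_def
    by (auto simp: length_Suc_conv eq_commute[of "Suc 0"])
  then show ?thesis unfolding up_def by auto
qed

lemma pcas_nth:
  assumes "pcas u p v" "i < length p"
  shows "fst (p ! i) = (if i = 0 then u else snd (p ! (i - 1)))"
  using assms by (induction u p v arbitrary: i rule: pcas.induct) (auto simp: nth_Cons')

lemma pcas_end: "pcas u p v \<Longrightarrow> p \<noteq> [] \<Longrightarrow> snd (last p) = v"
  by (induction u p v rule: pcas.induct) auto

locale word_encoding =
  fixes enc :: "nat list \<Rightarrow> 'a" and d m :: nat
  assumes inj_enc: "inj enc" and d_pos: "0 < d" and m_pos: "0 < m"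
begin

definition aug_graph :: "(nat list \<Rightarrow> nat set) \<Rightarrow> 'a pair_pre_digraph" where
  "aug_graph f = \<lparr>pverts = enc ` words d m, parcs = map_prod enc enc ` edges d m f\<rparr>"

abbreviation "word_tree \<equiv> aug_graph (\<lambda>_. {})"
abbreviation "rt \<equiv> enc []"

lemma enc_eq_iff [simp]: "enc x = enc y \<longleftrightarrow> x = y"
  using inj_enc by (simp add: inj_eq)

lemma arc_iff [simp]: "(enc x, enc y) \<in> parcs (aug_graph f) \<longleftrightarrow> (x, y) \<in> edges d m f"
  unfolding aug_graph_def by force

lemma vert_iff [simp]: "enc x \<in> pverts (aug_graph f) \<longleftrightarrow> x \<in> words d m"
  unfolding aug_graph_def by auto

lemma arcE:
  assumes "(a, b) \<in> parcs (aug_graph f)"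
  obtains x y where "a = enc x" "b = enc y" "(x, y) \<in> edges d m f"
  using assms unfolding aug_graph_def by auto

lemma vertE:
  assumes "a \<in> pverts (aug_graph f)"
  obtains w where "a = enc w" "w \<in> words d m"
  using assms unfolding aug_graph_def by auto

lemma pair_graph_aug_graph: "pair_graph (aug_graph f)"
proof
  fix e assume "e \<in> parcs (aug_graph f)"
  then obtain x y where e: "e = (enc x, enc y)" "(x, y) \<in> edges d m f"
    by (metis arcE surj_pair)
  then show "fst e \<in> pverts (aug_graph f)" "snd e \<in> pverts (aug_graph f)"
    using edges_in_words by auto
  show "fst e \<noteq> snd e" using e edges_length_neq by fastforce
next
  show "finite (pverts (aug_graph f))" unfolding aug_graph_def by (simp add: finite_words)
  have "finite (edges d m f)"
    using edges_in_words by (rule finite_subset) (simp add: finite_words)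
  then show "finite (parcs (aug_graph f))" unfolding aug_graph_def by simp
  show "symmetric (with_proj (aug_graph f))"
    unfolding symmetric_def by (rule symI) (auto elim!: arcE simp: edges_sym)
qed

text \<open>
  The heads of the arcs of \<open>p\<close>, continued periodically, are the required sequence: \<open>distinct\<close> is
  known of the vertices without the first, which are exactly these heads.
\<close>

lemma closed_cycle_of_graph_cycle:
  assumes "graph_cycle (aug_graph f) p"
  shows "\<exists>c. closed_cycle (edges d m f) (length p) c"
proof -
  interpret G: pair_graph "aug_graph f" by (rule pair_graph_aug_graph)
  let ?n = "length p"
  from assms obtain u where p: "set p \<subseteq> parcs (aug_graph f)" "pcas u p u"
    "distinct (tl (pawalk_verts u p))" "p \<noteq> []" and n: "3 \<le> ?n"
    unfolding graph_cycle_def G.cycle_def G.awalk_def by auto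
  have "distinct (map snd p)"
    using p(3,4) G.awalk_verts_conv'[OF p(2)] by simp
  have "\<exists>w. snd (p ! (i mod ?n)) = enc w" for i
  proof -
    have "p ! (i mod ?n) \<in> parcs (aug_graph f)" using p n by (intro subsetD[OF p(1)] nth_mem) auto
    then show ?thesis by (metis arcE prod.collapse)
  qed
  then obtain c where c: "\<And>i. snd (p ! (i mod ?n)) = enc (c i)" by metis
  have fst: "fst (p ! (Suc i mod ?n)) = enc (c i)" for i
  proof (cases "Suc (i mod ?n) = ?n")
    case True
    then have "snd (p ! (i mod ?n)) = u"
      using pcas_end[OF p(2,4)] p(4) True by (metis last_conv_nth diff_Suc_1)
    then show ?thesis using pcas_nth[OF p(2), of 0] p(4) c[of i] True by (simp add: mod_Suc)
  next
    case False
    then have "Suc i mod ?n = Suc (i mod ?n)" by (simp add: mod_Suc)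
    moreover have "Suc i mod ?n < ?n" using p(4) by (intro mod_less_divisor) simp
    ultimately have "Suc i mod ?n = Suc (i mod ?n)" "Suc (i mod ?n) < ?n" by simp_all
    then show ?thesis using pcas_nth[OF p(2), of "Suc (i mod ?n)"] c[of i] by simp
  qed
  have "(c i, c (Suc i)) \<in> edges d m f" for i
  proof -
    have "p ! (Suc i mod ?n) \<in> parcs (aug_graph f)"
      using p n by (intro subsetD[OF p(1)] nth_mem) auto
    then have "(enc (c i), enc (c (Suc i))) \<in> parcs (aug_graph f)"
      using fst[of i] c[of "Suc i"] by (metis prod.collapse)
    then show ?thesis by simp
  qed
  moreover have "c (i + ?n) = c i" for i
    using c[of i] c[of "i + ?n"] by simp
  moreover have "inj_on c {..<?n}"
  proof (rule inj_onI)
    fix i j assume ij: "i \<in> {..<?n}" "j \<in> {..<?n}" "c i = c j"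
    then have "map snd p ! i = map snd p ! j" using c[of i] c[of j] by simp
    then show "i = j" using \<open>distinct (map snd p)\<close> ij by (simp add: nth_eq_iff_index_eq del: nth_map)
  qed
  ultimately show ?thesis using n unfolding closed_cycle_def by blast
qed

lemma girth_aug_graph:
  assumes "girth_at_least (edges d m f) g"
  shows "enat g \<le> girth (aug_graph f)"
  unfolding girth_def
proof (rule INF_greatest)
  fix p assume "p \<in> {p. graph_cycle (aug_graph f) p}"
  then show "enat g \<le> enat (length p)"
    using closed_cycle_of_graph_cycle assms unfolding girth_at_least_def by auto
qed

lemma bipartite_aug_graph:
  assumes "depth_choice d r m f"
  shows "bipartite (aug_graph f)"
proof -
  have parity: "even (length w) \<longleftrightarrow> odd (length y)" if "(w, y) \<in> up d m f" for w y
  proof -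
    from that have w: "set w \<subseteq> {..<d}"
      "Suc (length y) = length w \<or> length w = m \<and> length y \<in> f w"
      unfolding up_def words_def by auto
    from w(2) show ?thesis
    proof
      assume "Suc (length y) = length w"
      then show ?thesis by (metis even_Suc)
    next
      assume "length w = m \<and> length y \<in> f w"
      then show ?thesis using assms w(1) unfolding depth_choice_def by auto
    qed
  qed
  let ?X = "{w \<in> words d m. even (length w)}" and ?Y = "{w \<in> words d m. odd (length w)}"
  have "edges d m f \<subseteq> ?X \<times> ?Y \<union> ?Y \<times> ?X"
    using edges_in_words[of d m f] parity unfolding edges_def by blast
  then have "parcs (aug_graph f) \<subseteq> enc ` ?X \<times> enc ` ?Y \<union> enc ` ?Y \<times> enc ` ?X"
    unfolding aug_graph_def by auto
  moreover have "pverts (aug_graph f) = enc ` ?X \<union> enc ` ?Y" unfolding aug_graph_def by auto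
  moreover have "enc ` ?X \<inter> enc ` ?Y = {}" by auto
  ultimately show ?thesis unfolding bipartite_def by blast
qed

definition root_path :: "nat list \<Rightarrow> ('a \<times> 'a) awalk" where
  "root_path w = map (\<lambda>i. (enc (take i w), enc (take (Suc i) w))) [0..<length w]"

lemma root_path_snoc: "root_path (w @ [x]) = root_path w @ [(enc w, enc (w @ [x]))]"
  unfolding root_path_def by simp

lemma tree_edge_iff:
  "(x, y) \<in> edges d m (\<lambda>_. {}) \<longleftrightarrow>
    x \<in> words d m \<and> (\<exists>a. x = y @ [a]) \<or> y \<in> words d m \<and> (\<exists>a. y = x @ [a])"
  unfolding edges_def by (auto simp: up_tree_iff)

lemma set_root_path_verts: "set (pawalk_verts rt (root_path w)) = enc ` {y. prefix y w}"
proof -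
  interpret G: pair_graph word_tree by (rule pair_graph_aug_graph)
  show ?thesis
  proof (induction w rule: rev_induct)
    case Nil
    then show ?case by (simp add: root_path_def)
  next
    case (snoc x w)
    have "set (pawalk_verts rt (root_path (w @ [x]))) =
        insert (enc (w @ [x])) (set (pawalk_verts rt (root_path w)))"
      unfolding root_path_snoc G.awalk_verts_conv
      by (cases w rule: rev_cases) (auto simp: root_path_snoc root_path_def)
    then show ?case unfolding snoc by auto
  qed
qed

lemma root_path_apath:
  assumes "w \<in> words d m"
  shows "pre_digraph.apath (with_proj word_tree) rt (root_path w) (enc w)"
proof -
  interpret G: pair_graph word_tree by (rule pair_graph_aug_graph)
  show ?thesis using assms
  proof (induction w rule: rev_induct)
    case Nil
    then show ?case by (simp add: root_path_def G.apath_Nil_iff)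
  next
    case (snoc x w)
    then have IH: "G.apath rt (root_path w) (enc w)" by (simp add: snoc_in_words_iff)
    have "(w, w @ [x]) \<in> edges d m (\<lambda>_. {})" using snoc.prems by (simp add: tree_edge_iff)
    moreover have "last (pawalk_verts rt (root_path w)) = enc w"
      using G.awalkI_apath[OF IH] by auto
    ultimately show ?case using IH snoc.prems unfolding root_path_snoc G.apath_append_iff
      by (auto simp: G.apath_simps set_root_path_verts)
  qed
qed

text \<open>
  A path from the root that has reached \<open>w\<close> has visited all prefixes of \<open>w\<close>, so that the next edge
  cannot go back to the parent and must append a letter.
\<close>

lemma apath_is_root_path:
  assumes "pre_digraph.apath (with_proj word_tree) rt p v"
  shows "\<exists>w \<in> words d m. v = enc w \<and> p = root_path w"
proof -
  interpret G: pair_graph word_tree by (rule pair_graph_aug_graph)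
  show ?thesis using assms
  proof (induction p arbitrary: v rule: rev_induct)
    case Nil
    then show ?case by (auto simp: G.apath_Nil_iff root_path_def Nil_in_words)
  next
    case (snoc a p)
    let ?l = "last (pawalk_verts rt p)"
    from snoc.prems have l: "G.apath rt p ?l" "G.apath ?l [a] v" "v \<notin> set (pawalk_verts rt p)"
      unfolding G.apath_append_iff by (auto simp: G.apath_simps)
    from snoc.IH[OF l(1)] obtain w where w: "w \<in> words d m" "?l = enc w" "p = root_path w" by blast
    from l(2) w have a: "a = (enc w, v)" "(enc w, v) \<in> parcs word_tree"
      by (cases a; auto simp: G.apath_simps)+
    then obtain y where y: "v = enc y" "(w, y) \<in> edges d m (\<lambda>_. {})"
      by (metis arcE enc_eq_iff)
    then have "\<not> prefix y w" using l(3) w set_root_path_verts by auto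
    then obtain x where "y = w @ [x]" "y \<in> words d m" using y(2) by (auto simp: tree_edge_iff)
    then show ?case using a y w by (auto simp: root_path_snoc)
  qed
qed

lemma ancestor_iff:
  "ancestor word_tree rt u v \<longleftrightarrow> (\<exists>w \<in> words d m. \<exists>y. strict_prefix y w \<and> u = enc y \<and> v = enc w)"
proof
  assume "ancestor word_tree rt u v"
  then obtain w where "w \<in> words d m" "v = enc w" "u \<in> set (pawalk_verts rt (root_path w))" "u \<noteq> v"
    unfolding ancestor_def using apath_is_root_path by blast
  then show "\<exists>w \<in> words d m. \<exists>y. strict_prefix y w \<and> u = enc y \<and> v = enc w"
    unfolding set_root_path_verts by (auto simp: strict_prefix_def)
next
  assume "\<exists>w \<in> words d m. \<exists>y. strict_prefix y w \<and> u = enc y \<and> v = enc w"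
  then obtain w y where "w \<in> words d m" "strict_prefix y w" "u = enc y" "v = enc w" by blast
  then show "ancestor word_tree rt u v"
    unfolding ancestor_def using root_path_apath[of w] set_root_path_verts[of w]
    by (auto simp: strict_prefix_def intro!: exI[of _ "root_path w"])
qed

lemma parent_iff:
  "parent word_tree rt u v \<longleftrightarrow> (\<exists>y x. y @ [x] \<in> words d m \<and> u = enc y \<and> v = enc (y @ [x]))"
  unfolding parent_def ancestor_iff
  by (auto simp: tree_edge_iff) (auto simp: strict_prefix_def)

lemma children_eq:
  assumes "w \<in> words d m"
  shows "children word_tree rt (enc w) = (if length w < m then (\<lambda>x. enc (w @ [x])) ` {..<d} else {})"
  unfolding children_def parent_iff using assms by (auto simp: snoc_in_words_iff)

lemma leaves_eq: "leaves word_tree rt = enc ` {w. set w \<subseteq> {..<d} \<and> length w = m}"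
proof -
  have "children word_tree rt (enc w) = {} \<longleftrightarrow> length w = m" if "w \<in> words d m" for w
    using that d_pos unfolding children_eq[OF that] words_def by auto
  then have "{w \<in> words d m. children word_tree rt (enc w) = {}} = {w \<in> words d m. length w = m}"
    by blast
  moreover have "leaves word_tree rt = enc ` {w \<in> words d m. children word_tree rt (enc w) = {}}"
    unfolding leaves_def by (auto elim!: vertE)
  ultimately have "leaves word_tree rt = enc ` {w \<in> words d m. length w = m}" by simp
  also have "{w \<in> words d m. length w = m} = {w. set w \<subseteq> {..<d} \<and> length w = m}"
    unfolding words_def by auto
  finally show ?thesis .
qed

lemma rooted_tree_word_tree: "rooted_tree word_tree rt"
proof -
  interpret G: pair_graph word_tree by (rule pair_graph_aug_graph)
  have acyclic: "\<not> graph_cycle word_tree p" for p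
    using closed_cycle_of_graph_cycle[of "\<lambda>_. {}" p] closed_cycle_visits_leaf by blast
  have from_root: "rt \<rightarrow>\<^sup>*\<^bsub>with_proj word_tree\<^esub> v" and to_root: "v \<rightarrow>\<^sup>*\<^bsub>with_proj word_tree\<^esub> rt"
    if v: "v \<in> pverts word_tree" for v
  proof -
    obtain w where w: "v = enc w" "w \<in> words d m" using vertE[OF v] by blast
    have "G.awalk rt (root_path w) v"
      using root_path_apath[OF w(2)] w(1) by (simp add: G.awalkI_apath)
    then show "rt \<rightarrow>\<^sup>*\<^bsub>with_proj word_tree\<^esub> v" "v \<rightarrow>\<^sup>*\<^bsub>with_proj word_tree\<^esub> rt"
      unfolding G.reachable_awalk by (blast intro: G.awalk_rev_path')+
  qed
  have "connected (with_proj word_tree)"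
    unfolding connected_def
  proof (rule strongly_connectedI)
    show "verts (with_proj (mk_symmetric (with_proj word_tree))) \<noteq> {}"
      using Nil_in_words by (fastforce simp: mk_symmetric_def aug_graph_def)
    fix u v assume "u \<in> verts (with_proj (mk_symmetric (with_proj word_tree)))"
      "v \<in> verts (with_proj (mk_symmetric (with_proj word_tree)))"
    then have "u \<in> pverts word_tree" "v \<in> pverts word_tree" by (simp_all add: mk_symmetric_def)
    then have "u \<rightarrow>\<^sup>*\<^bsub>with_proj word_tree\<^esub> v" using from_root to_root G.reachable_trans by blast
    then show "u \<rightarrow>\<^sup>*\<^bsub>with_proj (mk_symmetric (with_proj word_tree))\<^esub> v"
      by (rule G.reachable_mk_symmetricI)
  qed
  then show ?thesis
    unfolding rooted_tree_def using pair_graph_aug_graph acyclic by (auto simp: Nil_in_words)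
qed

text \<open>
  Each edge of the tree lengthens a word by at most one letter.
\<close>

lemma awalk_length_ge:
  assumes "pre_digraph.awalk (with_proj word_tree) (enc x) p (enc w)"
  shows "length w \<le> length x + length p"
proof -
  interpret G: pair_graph word_tree by (rule pair_graph_aug_graph)
  show ?thesis using assms
  proof (induction p arbitrary: x)
    case Nil
    then show ?case by (simp add: G.awalk_Nil_iff)
  next
    case (Cons a p)
    then have "fst a = enc x" "a \<in> parcs word_tree" "G.awalk (snd a) p (enc w)"
      by (auto simp: G.awalk_Cons_iff)
    then obtain y where "snd a = enc y" "(x, y) \<in> edges d m (\<lambda>_. {})"
      by (metis arcE enc_eq_iff prod.collapse)
    then have "length y \<le> Suc (length x)" "length w \<le> length y + length p"
      using Cons.IH \<open>G.awalk (snd a) p (enc w)\<close> by (auto simp: tree_edge_iff)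
    then show ?case by simp
  qed
qed

lemma root_distance:
  assumes "w \<in> words d m"
  shows "wf_digraph.\<mu> (with_proj word_tree) (\<lambda>_. 1) rt (enc w) = ereal (real (length w))"
proof -
  interpret G: pair_graph word_tree by (rule pair_graph_aug_graph)
  have cost: "G.awalk_cost (\<lambda>_. 1) p = real (length p)" for p
    unfolding G.awalk_cost_def by (simp add: sum_list_triv)
  have "G.awalk rt (root_path w) (enc w)"
    using root_path_apath[OF assms] by (simp add: G.awalkI_apath)
  then have "G.\<mu> (\<lambda>_. 1) rt (enc w) \<le> ereal (real (length w))"
    using G.min_cost_le_walk_cost[of rt "root_path w" "enc w" "\<lambda>_. 1"]
    by (simp add: cost root_path_def)
  moreover have "ereal (real (length w)) \<le> G.\<mu> (\<lambda>_. 1) rt (enc w)"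
    unfolding G.\<mu>_def cost
    by (rule INF_greatest) (use awalk_length_ge[of "[]"] in auto)
  ultimately show ?thesis by (rule antisym)
qed

lemma complete_dary_tree_word_tree: "complete_dary_tree d m word_tree rt"
  unfolding complete_dary_tree_def
proof (intro conjI ballI)
  show "rooted_tree word_tree rt" by (rule rooted_tree_word_tree)
  fix l assume "l \<in> leaves word_tree rt"
  then obtain w where "l = enc w" "w \<in> words d m" "length w = m"
    unfolding leaves_eq words_def by auto
  then show "wf_digraph.\<mu> (with_proj word_tree) (\<lambda>_. 1) rt l = ereal (real m)"
    using root_distance[of w] by simp
next
  fix v assume v: "v \<in> pverts word_tree - leaves word_tree rt"
  then obtain w where w: "v = enc w" "w \<in> words d m" by (blast elim: vertE)
  then have "length w < m" using v unfolding leaves_eq words_def by auto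
  then show "card (children word_tree rt v) = d"
    using w children_eq[OF w(2)] by (simp add: card_image inj_on_def)
qed

lemma augmented_tree_aug_graph:
  assumes "depth_choice d r m f"
  shows "augmented_tree r (aug_graph f) word_tree rt"
  unfolding augmented_tree_def
proof (intro conjI)
  show "rooted_tree word_tree rt" by (rule rooted_tree_word_tree)
  show "pverts (aug_graph f) = pverts word_tree" unfolding aug_graph_def by simp
  let ?L = "{w. set w \<subseteq> {..<d} \<and> length w = m}"
  \<comment> \<open>\<open>f\<close> records depths; the ancestors themselves are the prefixes of these lengths.\<close>
  define A where "A v = (\<lambda>j. enc (take j (inv enc v))) ` f (inv enc v)" for v
  have A: "A (enc w) = (\<lambda>j. enc (take j w)) ` f w" for w
    unfolding A_def using inj_enc by simp
  have f: "f w \<subseteq> {j. odd j \<and> Suc j < m}" "card (f w) = r" if "w \<in> ?L" for w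
    using assms that unfolding depth_choice_def by auto
  have "card (A l) = r \<and> A l \<subseteq> {a. ancestor word_tree rt a l \<and> \<not> parent word_tree rt a l}"
    if "l \<in> leaves word_tree rt" for l
  proof -
    from that obtain w where w: "l = enc w" "w \<in> ?L" unfolding leaves_eq by auto
    have "inj_on (\<lambda>j. enc (take j w)) (f w)"
    proof (rule inj_onI)
      fix i j assume ij: "i \<in> f w" "j \<in> f w" "enc (take i w) = enc (take j w)"
      then have "length (take i w) = length (take j w)" by simp
      then show "i = j" using ij f(1)[OF w(2)] w(2) by auto
    qed
    then have "card (A l) = r" using f(2)[OF w(2)] by (simp add: w(1) A card_image)
    moreover have "ancestor word_tree rt (enc (take j w)) l \<and> \<not> parent word_tree rt (enc (take j w)) l"
      if "j \<in> f w" for j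
    proof -
      have j: "Suc j < length w" using that f(1)[OF w(2)] w(2) by auto
      have "w \<in> words d m" using w(2) unfolding words_def by simp
      moreover have "strict_prefix (take j w) w" using j unfolding strict_prefix_take_iff by simp
      moreover have "w \<noteq> take j w @ [x]" for x
      proof
        assume "w = take j w @ [x]"
        then have "length w = length (take j w @ [x])" by (rule arg_cong)
        then show False using j by simp
      qed
      ultimately show ?thesis unfolding ancestor_iff parent_iff w(1) by auto
    qed
    ultimately show ?thesis using A w(1) by auto
  qed
  moreover have "parcs (aug_graph f) = parcs word_tree \<union> (\<Union>l \<in> leaves word_tree rt. \<Union>a \<in> A l. {(l, a), (a, l)})"
  proof -
    let ?aug = "{(w, take j w) | w j. w \<in> ?L \<and> j \<in> f w}"
    have "up d m f = up d m (\<lambda>_. {}) \<union> ?aug"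
    proof (intro equalityI subsetI)
      fix e assume "e \<in> up d m f"
      then obtain w y where e: "e = (w, y)" "(w, y) \<in> up d m f" by (cases e) auto
      show "e \<in> up d m (\<lambda>_. {}) \<union> ?aug"
      proof (cases "length w = m \<and> length y \<in> f w")
        case True
        then have "w \<in> ?L" "y = take (length y) w"
          using e(2) unfolding up_def words_def strict_prefix_take_iff by auto
        then show ?thesis using True e(1) by blast
      next
        case False
        then show ?thesis using e unfolding up_def by auto
      qed
    next
      fix e assume "e \<in> up d m (\<lambda>_. {}) \<union> ?aug"
      then show "e \<in> up d m f"
      proof
        assume "e \<in> ?aug"
        then obtain w j where j: "e = (w, take j w)" "w \<in> ?L" "j \<in> f w" by auto
        then have "Suc j < m" using f(1) by blast
        then show ?thesis using j unfolding up_def words_def strict_prefix_take_iff by auto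
      qed (auto simp: up_def)
    qed
    then have "edges d m f = edges d m (\<lambda>_. {}) \<union> ?aug \<union> ?aug\<inverse>"
      unfolding edges_def by auto
    moreover have "map_prod enc enc ` (?aug \<union> ?aug\<inverse>) =
        (\<Union>l \<in> leaves word_tree rt. \<Union>a \<in> A l. {(l, a), (a, l)})"
      unfolding leaves_eq by (auto simp: A)
    ultimately show ?thesis unfolding aug_graph_def by (simp add: image_Un Un_assoc)
  qed
  ultimately show "\<exists>A. (\<forall>l \<in> leaves word_tree rt. card (A l) = r \<and>
             A l \<subseteq> {a. ancestor word_tree rt a l \<and> \<not> parent word_tree rt a l}) \<and>
          parcs (aug_graph f) = parcs word_tree \<union> (\<Union>l \<in> leaves word_tree rt. \<Union>a \<in> A l. {(l, a), (a, l)})"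
    by blast
qed

end

section \<open>Existence of graphs of large girth\<close>

theorem theorem1p3:
  fixes d r g :: nat
  assumes "0 < d" and "0 < r" and "0 < g"
  shows "\<exists>G :: nat pair_pre_digraph. drg_graph d r g G"
proof -
  obtain m f where f: "depth_choice d r m f" "girth_at_least (edges d m f) g"
    using depth_choice_exists by blast
  interpret word_encoding "to_nat :: nat list \<Rightarrow> nat" d m
    using f(1) assms(1) by unfold_locales (auto simp: depth_choice_def)
  have "drg_graph d r g (aug_graph f)"
    unfolding drg_graph_def
    using pair_graph_aug_graph complete_dary_tree_word_tree augmented_tree_aug_graph[OF f(1)]
      bipartite_aug_graph[OF f(1)] girth_aug_graph[OF f(2)] by blast
  then show ?thesis ..
qed

end
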